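(* Let $(X,\mathsf{d})$ be a finite metric space and let $\mu_{\sharp}$ be the counting measure on $X$. Then the following hold. (1) If the $\mu_{\sharp}$-magnitude $\mathrm{Mag}(X,\mathsf{d},\mu_{\sharp})$ exists, then $$\mathrm{Mag}(X,\mathsf{d},\mu_{\sharp},\Gamma^{\mathrm{triv}})=\mathrm{Mag}(X,\mathsf{d},\mu_{\sharp},\Gamma^{\sharp})=\mathrm{Mag}(X,\mathsf{d},\mu_{\sharp}),$$ where piecewise geodesics in the finite metric space $X$ are interpreted by the convention that any two distinct points are joined by exactly one geodesic. (2) Suppose that for all $x,y\in X$ the series $$\delta_{xy}+\sum_{n=1}^{\infty}\ \sum_{\substack{(x_0,\dots,x_n)\in P_n(X)\\ x_0=x,\ x_n=y}}(-1)^n q^{\mathsf{d}(x_0,x_1)+\mathsf{d}(x_1,x_2)+\cdots+\mathsf{d}(x_{n-1},x_n)}$$ converges absolutely for $q=e^{-1}$ and agrees with $(Z_X^{-1})_{xy}$, where $Z_X$ is the matrix with entries $(Z_X)_{xy}=e^{-\mathsf{d}(x,y)}$. Then the $\mu_{\sharp}$-magnitude of $(X,\mathsf{d})$ exists and agrees with the classical magnitude of $(X,\mathsf{d})$. (3) There exists $t_0>0$ such that, for all $t\ge t_0$, the $\mu_{\sharp}$-magnitude of $(X,t\mathsf{d})$ exists and agrees with the classical magnitude of $(X,t\mathsf{d})$.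
   Context: For $n\ge 1$, $P_n(X):=\{(x_0,\dots,x_n)\in X^{n+1}\mid x_{k-1}\ne x_k \text{ for all } k=1,\dots,n\}$ (proper chains). $\delta_{xy}$ is the Kronecker delta. Classical magnitude: for a finite metric space $(X,\mathsf{d})$, let $(Z_X)_{xy}=e^{-\mathsf{d}(x,y)}$; if $Z_X$ is invertible, the classical magnitude is $\mathrm{Mag}(X,\mathsf{d})=\sum_{x,y\in X}(Z_X^{-1})_{xy}$. $\mu$-magnitude: for a finite measure $\mu$ and $N\ge 1$, $$\mathrm{Mag}(X,\mathsf{d},\mu;N):=\mu(X)+\sum_{n=1}^N(-1)^n\int_{P_n(X)}e^{-\sum_{k=1}^n\mathsf{d}(x_{k-1},x_k)}\,\mathrm{d}\mu^{n+1},$$ where $\mu^{n+1}$ is the product measure on $X^{n+1}$, and $\mathrm{Mag}(X,\mathsf{d},\mu):=\lim_{N\to\infty}\mathrm{Mag}(X,\mathsf{d},\mu;N)$ when the limit exists in $\mathbb{R}\cup\{\pm\infty\}$. $(\mu,\Gamma)$-magnitude: let $\Omega_{x,y}$ be the set of geodesics from $x$ to $y$ (empty if $x=y$), carrying a measure $\Gamma_{x,y}$; for $\bm{x}\in P_n(X)$ set $\Omega_{\bm{x}}=\prod_{k=1}^n\Omega_{x_{k-1},x_k}$ with product measure $\Gamma_{\bm{x}}$, and $\mathrm{Len}(\gamma)=\sum_k\mathsf{d}(x_{k-1},x_k)$ for $\gamma\in\Omega_{\bm x}$. Then $$\mathrm{Mag}(X,\mathsf{d},\mu,\Gamma;N):=\mu(X)+\sum_{n=1}^N(-1)^n\int_{P_n(X)}\Big(\int_{\Omega_{\bm{x}}}e^{-\mathrm{Len}(\gamma)}\,\mathrm{d}\Gamma_{\bm{x}}\Big)\mathrm{d}\mu^{n+1},$$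 and $\mathrm{Mag}(X,\mathsf{d},\mu,\Gamma)$ is the limit as $N\to\infty$ when it exists in $\mathbb{R}\cup\{\pm\infty\}$. Convention for finite metric spaces: for $x\neq y$, $\Omega_{x,y}$ is declared to be a singleton. $\Gamma^{\mathrm{triv}}_{x,y}$ is the measure on the $\sigma$-algebra $\{\emptyset,\Omega_{x,y}\}$ with total mass $1$ if $\Omega_{x,y}\ne\emptyset$; $\Gamma^{\sharp}_{x,y}$ is the counting measure on $\Omega_{x,y}$. *)

theory Defs
  imports "HOL-Analysis.Analysis"
begin

text \<open>
  A finite metric space is a finite carrier \<open>X\<close> with \<open>Metric_space X d\<close>. An \<open>(n+1)\<close>-tuple
  \<open>(x\<^sub>0, \<dots>, x\<^sub>n)\<close> in \<open>X\<close> is an extensional function on \<open>{0..n}\<close>, so that the product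
  measure on \<open>X\<^sup>n\<^sup>+\<^sup>1\<close> is \<open>PiM {0..n} (\<lambda>_. \<mu>)\<close>.
\<close>

definition proper_chains :: "'a set \<Rightarrow> nat \<Rightarrow> (nat \<Rightarrow> 'a) set" where
  "proper_chains X n = {x \<in> {0..n} \<rightarrow>\<^sub>E X. \<forall>k\<in>{1..n}. x (k - 1) \<noteq> x k}"

definition chain_length :: "('a \<Rightarrow> 'a \<Rightarrow> real) \<Rightarrow> nat \<Rightarrow> (nat \<Rightarrow> 'a) \<Rightarrow> real" where
  "chain_length d n x = (\<Sum>k=1..n. d (x (k - 1)) (x k))"


subsection \<open>Classical magnitude\<close>

text \<open>Square matrices with rows and columns indexed by the finite set \<open>X\<close> are functions of two
  arguments of which only the values on \<open>X\<close> matter. (The matrices of the library are indexed by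
  types, which would exclude the empty space.)\<close>

definition inverse_matrices_on ::
    "'a set \<Rightarrow> ('a \<Rightarrow> 'a \<Rightarrow> real) \<Rightarrow> ('a \<Rightarrow> 'a \<Rightarrow> real) \<Rightarrow> bool" where
  "inverse_matrices_on X A B \<longleftrightarrow>
     (\<forall>x\<in>X. \<forall>y\<in>X. (\<Sum>z\<in>X. A x z * B z y) = (if x = y then 1 else 0) \<and>
                  (\<Sum>z\<in>X. B x z * A z y) = (if x = y then 1 else 0))"

definition invertible_matrix_on :: "'a set \<Rightarrow> ('a \<Rightarrow> 'a \<Rightarrow> real) \<Rightarrow> bool" where
  "invertible_matrix_on X A \<longleftrightarrow> (\<exists>B. inverse_matrices_on X A B)"

text \<open>The entries with indices in \<open>X\<close> do not depend on the choice; unspecified if \<open>A\<close> is not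
  invertible.\<close>

definition matrix_inverse_on :: "'a set \<Rightarrow> ('a \<Rightarrow> 'a \<Rightarrow> real) \<Rightarrow> 'a \<Rightarrow> 'a \<Rightarrow> real" where
  "matrix_inverse_on X A = (SOME B. inverse_matrices_on X A B)"

definition zeta_matrix :: "('a \<Rightarrow> 'a \<Rightarrow> real) \<Rightarrow> 'a \<Rightarrow> 'a \<Rightarrow> real" where
  "zeta_matrix d x y = exp (- d x y)"

text \<open>Meaningful only under \<open>invertible_matrix_on X (zeta_matrix d)\<close>.\<close>

definition classical_magnitude :: "'a set \<Rightarrow> ('a \<Rightarrow> 'a \<Rightarrow> real) \<Rightarrow> real" where
  "classical_magnitude X d = (\<Sum>x\<in>X. \<Sum>y\<in>X. matrix_inverse_on X (zeta_matrix d) x y)"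


subsection \<open>The magnitude with respect to a measure\<close>

definition mu_magnitude_upto ::
    "'a set \<Rightarrow> ('a \<Rightarrow> 'a \<Rightarrow> real) \<Rightarrow> 'a measure \<Rightarrow> nat \<Rightarrow> real" where
  "mu_magnitude_upto X d \<mu> N = measure \<mu> X +
     (\<Sum>n=1..N. (-1) ^ n *
        (LINT x : proper_chains X n | PiM {0..n} (\<lambda>_. \<mu>). exp (- chain_length d n x)))"

text \<open>Limits are taken in \<open>ereal\<close>, so an infinite limit counts as existing.\<close>

definition mu_magnitude_exists ::
    "'a set \<Rightarrow> ('a \<Rightarrow> 'a \<Rightarrow> real) \<Rightarrow> 'a measure \<Rightarrow> bool" where
  "mu_magnitude_exists X d \<mu> \<longleftrightarrow> convergent (\<lambda>N. ereal (mu_magnitude_upto X d \<mu> N))"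

definition mu_magnitude :: "'a set \<Rightarrow> ('a \<Rightarrow> 'a \<Rightarrow> real) \<Rightarrow> 'a measure \<Rightarrow> ereal" where
  "mu_magnitude X d \<mu> = lim (\<lambda>N. ereal (mu_magnitude_upto X d \<mu> N))"


subsection \<open>The magnitude with respect to measures on points and on geodesics\<close>

text \<open>The set of geodesics from \<open>x\<close> to \<open>y\<close> is \<open>space (\<Gamma> x y)\<close>, so the piecewise geodesics along the
  chain \<open>x\<close> form the space of the product measure below, and each of them has length
  \<open>chain_length d n x\<close>. The integrals are Bochner integrals, hence
  \<open>0\<close> for a non-integrable integrand; on a finite space with \<open>\<mu>\<close> and all \<open>\<Gamma> x y\<close> finite,
  as below, this does not occur.\<close>

definition chain_geodesic_measure ::
    "('a \<Rightarrow> 'a \<Rightarrow> 'g measure) \<Rightarrow> nat \<Rightarrow> (nat \<Rightarrow> 'a) \<Rightarrow> (nat \<Rightarrow> 'g) measure" where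
  "chain_geodesic_measure \<Gamma> n x = PiM {1..n} (\<lambda>k. \<Gamma> (x (k - 1)) (x k))"

definition mu_Gamma_magnitude_upto ::
    "'a set \<Rightarrow> ('a \<Rightarrow> 'a \<Rightarrow> real) \<Rightarrow> 'a measure \<Rightarrow> ('a \<Rightarrow> 'a \<Rightarrow> 'g measure) \<Rightarrow> nat \<Rightarrow> real" where
  "mu_Gamma_magnitude_upto X d \<mu> \<Gamma> N = measure \<mu> X +
     (\<Sum>n=1..N. (-1) ^ n *
        (LINT x : proper_chains X n | PiM {0..n} (\<lambda>_. \<mu>).
           (LINT \<gamma> | chain_geodesic_measure \<Gamma> n x. exp (- chain_length d n x))))"

definition mu_Gamma_magnitude_exists ::
    "'a set \<Rightarrow> ('a \<Rightarrow> 'a \<Rightarrow> real) \<Rightarrow> 'a measure \<Rightarrow> ('a \<Rightarrow> 'a \<Rightarrow> 'g measure) \<Rightarrow> bool" where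
  "mu_Gamma_magnitude_exists X d \<mu> \<Gamma> \<longleftrightarrow>
     convergent (\<lambda>N. ereal (mu_Gamma_magnitude_upto X d \<mu> \<Gamma> N))"

definition mu_Gamma_magnitude ::
    "'a set \<Rightarrow> ('a \<Rightarrow> 'a \<Rightarrow> real) \<Rightarrow> 'a measure \<Rightarrow> ('a \<Rightarrow> 'a \<Rightarrow> 'g measure) \<Rightarrow> ereal" where
  "mu_Gamma_magnitude X d \<mu> \<Gamma> = lim (\<lambda>N. ereal (mu_Gamma_magnitude_upto X d \<mu> \<Gamma> N))"

text \<open>In a finite metric space the geodesics are purely formal: by convention \<open>\<Omega> x y\<close> has exactly
  one element if \<open>x \<noteq> y\<close>, and none if \<open>x = y\<close>.\<close>

definition unique_formal_geodesics :: "'a set \<Rightarrow> ('a \<Rightarrow> 'a \<Rightarrow> 'g set) \<Rightarrow> bool" where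
  "unique_formal_geodesics X \<Omega> \<longleftrightarrow>
     (\<forall>x\<in>X. \<forall>y\<in>X. if x = y then \<Omega> x y = {} else is_singleton (\<Omega> x y))"

definition Gamma_triv :: "('a \<Rightarrow> 'a \<Rightarrow> 'g set) \<Rightarrow> 'a \<Rightarrow> 'a \<Rightarrow> 'g measure" where
  "Gamma_triv \<Omega> x y = measure_of (\<Omega> x y) {{}, \<Omega> x y} (\<lambda>A. if A = {} then 0 else 1)"

definition Gamma_sharp :: "('a \<Rightarrow> 'a \<Rightarrow> 'g set) \<Rightarrow> 'a \<Rightarrow> 'a \<Rightarrow> 'g measure" where
  "Gamma_sharp \<Omega> x y = count_space (\<Omega> x y)"


subsection \<open>The chain series of a pair of points\<close>

definition chain_series_term ::
    "'a set \<Rightarrow> ('a \<Rightarrow> 'a \<Rightarrow> real) \<Rightarrow> real \<Rightarrow> 'a \<Rightarrow> 'a \<Rightarrow> nat \<Rightarrow> real" where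
  "chain_series_term X d q x y n =
     (\<Sum>c\<in>{c \<in> proper_chains X n. c 0 = x \<and> c n = y}. (-1) ^ n * q powr chain_length d n c)"

text \<open>Absolute convergence of the series over \<open>n\<close> is the same as absolute convergence of the
  double series over all chains, since for fixed \<open>n\<close> all summands have the same sign.\<close>

definition chain_series_abs_convergent ::
    "'a set \<Rightarrow> ('a \<Rightarrow> 'a \<Rightarrow> real) \<Rightarrow> real \<Rightarrow> 'a \<Rightarrow> 'a \<Rightarrow> bool" where
  "chain_series_abs_convergent X d q x y \<longleftrightarrow>
     summable (\<lambda>n. \<bar>chain_series_term X d q x y (Suc n)\<bar>)"

definition chain_series :: "'a set \<Rightarrow> ('a \<Rightarrow> 'a \<Rightarrow> real) \<Rightarrow> real \<Rightarrow> 'a \<Rightarrow> 'a \<Rightarrow> real" where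
  "chain_series X d q x y =
     (if x = y then 1 else 0) + (\<Sum>n. chain_series_term X d q x y (Suc n))"

end

theory Submission
  imports Defs "HOL-Probability.Infinite_Product_Measure" "HOL-Real_Asymp.Real_Asymp"
begin

text \<open>
  With one formal geodesic per pair of distinct points, every space of piecewise geodesics along a
  proper chain has mass 1, so the inner integrals disappear.
  Let \<open>Z\<close> be the zeta matrix and \<open>A = Z - 1\<close> its off-diagonal part. Summing \<open>exp (- length)\<close> over the
  proper chains with \<open>n\<close> steps from \<open>x\<close> to \<open>y\<close> gives the entry of \<open>A ^ n\<close>, so the chain series is the
  Neumann series of \<open>Z = 1 + A\<close> and its sum over all pairs of points is the magnitude series.
  When the distances are scaled up, the entries of \<open>A\<close> tend to 0; once they are below \<open>1 / card X\<close>,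
  the Neumann series converges absolutely and its sum inverts \<open>Z\<close>.
\<close>

subsection \<open>Integrals over chains as finite sums\<close>

lemma finite_proper_chains [simp]: "finite X \<Longrightarrow> finite (proper_chains X n)"
  by (rule finite_subset[of _ "{0..n} \<rightarrow>\<^sub>E X"]) (auto simp: proper_chains_def intro!: finite_PiE)

text \<open>A finite product of counting measures on a finite set is the counting measure on the
  finite set of tuples. So every set is measurable and every function integrable, and the default
  value 0 of the Bochner integral never enters.\<close>

lemma set_integral_proper_chains:
  fixes f :: "(nat \<Rightarrow> 'a) \<Rightarrow> real"
  assumes "finite X"
  shows "(LINT x : proper_chains X n | PiM {0..n} (\<lambda>_. count_space X). f x) =
    (\<Sum>x\<in>proper_chains X n. f x)"
proof -
  have eq: "PiM {0..n} (\<lambda>_. count_space X) = count_space ({0..n} \<rightarrow>\<^sub>E X)"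
    using assms by (intro count_space_PiM_finite) (auto intro: countable_finite)
  have "finite ({0..n} \<rightarrow>\<^sub>E X)"
    using assms by (auto intro!: finite_PiE)
  moreover have "proper_chains X n \<subseteq> {0..n} \<rightarrow>\<^sub>E X"
    by (auto simp: proper_chains_def)
  ultimately show ?thesis
    unfolding eq set_lebesgue_integral_def
    by (subst lebesgue_integral_count_space_finite)
       (auto intro!: sum.mono_neutral_cong_right simp: indicator_def)
qed

text \<open>Over a one-point space the trivial sigma-algebra is already the full power set, and mass
  1 is the cardinality.\<close>

lemma Gamma_triv_eq_count_space:
  assumes "is_singleton (\<Omega> x y)"
  shows "Gamma_triv \<Omega> x y = count_space (\<Omega> x y)"
proof -
  obtain g where g: "\<Omega> x y = {g}"
    using assms by (auto simp: is_singleton_def)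
  have Pow: "{{}, {g}} = Pow {g}"
    by auto
  have "measure_of {g} (Pow {g}) (\<lambda>A. if A = {} then 0 else 1) =
      measure_of {g} (Pow {g}) (\<lambda>A. if finite A then of_nat (card A) else \<infinity>)"
    by (rule measure_of_eq) (auto simp: sigma_algebra.sigma_sets_eq[OF sigma_algebra_Pow] subset_singleton_iff)
  then show ?thesis
    unfolding Gamma_triv_def g Pow count_space_def .
qed

text \<open>The product has only one-point probability spaces as factors. Properness of the chain is
  essential: a repeated point would contribute an empty factor. The condition on
  \<open>\<Gamma>\<close> is stated so that it covers both \<open>Gamma_triv\<close> and
  \<open>Gamma_sharp\<close>.\<close>

lemma measure_chain_geodesic_measure:
  assumes \<Omega>: "unique_formal_geodesics X \<Omega>" and c: "c \<in> proper_chains X n"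
    and \<Gamma>: "\<And>x y. is_singleton (\<Omega> x y) \<Longrightarrow> \<Gamma> x y = count_space (\<Omega> x y)"
  shows "measure (chain_geodesic_measure \<Gamma> n c) (space (chain_geodesic_measure \<Gamma> n c)) = 1"
proof -
  have "prob_space (chain_geodesic_measure \<Gamma> n c)"
    unfolding chain_geodesic_measure_def
  proof (rule prob_space_PiM)
    fix k assume k: "k \<in> {1..n}"
    then have "c (k - 1) \<in> X" "c k \<in> X" "c (k - 1) \<noteq> c k"
      using c by (auto simp: proper_chains_def PiE_iff)
    then have sing: "is_singleton (\<Omega> (c (k - 1)) (c k))"
      using \<Omega> by (auto simp: unique_formal_geodesics_def)
    then obtain g where "\<Omega> (c (k - 1)) (c k) = {g}"
      by (auto simp: is_singleton_def)
    then show "prob_space (\<Gamma> (c (k - 1)) (c k))"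
      using \<Gamma>[OF sing] by (auto intro!: prob_spaceI)
  qed
  then show ?thesis
    by (rule prob_space.prob_space)
qed

text \<open>The inner integrand does not depend on the geodesic, so the inner integral is that
  constant times the total mass 1. The partial sums agree as functions of \<open>N\<close>, hence
  existence of the limit transfers together with its value.\<close>

lemma mu_Gamma_magnitude_upto_eq:
  assumes "finite X" "unique_formal_geodesics X \<Omega>"
    and "\<And>x y. is_singleton (\<Omega> x y) \<Longrightarrow> \<Gamma> x y = count_space (\<Omega> x y)"
  shows "mu_Gamma_magnitude_upto X d (count_space X) \<Gamma> = mu_magnitude_upto X d (count_space X)"
  using assms
  by (intro ext)
     (simp add: mu_Gamma_magnitude_upto_def mu_magnitude_upto_def set_integral_proper_chains
       measure_chain_geodesic_measure cong: sum.cong)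


subsection \<open>Chain sums as matrix powers\<close>

text \<open>The sign is left out: these nonnegative numbers are the absolute values of the terms of
  the chain series at \<open>exp (-1)\<close>.\<close>

definition chain_sum :: "'a set \<Rightarrow> ('a \<Rightarrow> 'a \<Rightarrow> real) \<Rightarrow> nat \<Rightarrow> 'a \<Rightarrow> 'a \<Rightarrow> real" where
  "chain_sum X d n x y =
    (\<Sum>c\<in>{c \<in> proper_chains X n. c 0 = x \<and> c n = y}. exp (- chain_length d n c))"

definition offdiag_zeta :: "('a \<Rightarrow> 'a \<Rightarrow> real) \<Rightarrow> 'a \<Rightarrow> 'a \<Rightarrow> real" where
  "offdiag_zeta d x y = (if x = y then 0 else exp (- d x y))"

lemma chain_series_term_eq_chain_sum:
  "chain_series_term X d (exp (-1)) x y n = (-1) ^ n * chain_sum X d n x y"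
  by (simp add: chain_series_term_def chain_sum_def sum_distrib_left powr_def)

lemma sum_proper_chains:
  assumes "finite X"
  shows "(\<Sum>c\<in>proper_chains X n. exp (- chain_length d n c)) =
    (\<Sum>x\<in>X. \<Sum>y\<in>X. chain_sum X d n x y)"
proof -
  have "(\<Sum>c\<in>proper_chains X n. exp (- chain_length d n c)) =
      (\<Sum>p\<in>X \<times> X. \<Sum>c\<in>{c \<in> proper_chains X n. (c 0, c n) = p}. exp (- chain_length d n c))"
    using assms
    by (intro sum.group[symmetric] finite_proper_chains finite_cartesian_product) (auto simp: proper_chains_def PiE_iff)
  also have "\<dots> = (\<Sum>x\<in>X. \<Sum>y\<in>X. chain_sum X d n x y)"
    by (simp add: sum.cartesian_product chain_sum_def case_prod_beta prod_eq_iff)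
  finally show ?thesis .
qed

lemma chain_sum_0:
  assumes "x \<in> X"
  shows "chain_sum X d 0 x y = (if x = y then 1 else 0)"
proof -
  have "{c \<in> proper_chains X 0. c 0 = x \<and> c 0 = y} = (if x = y then {\<lambda>i\<in>{0}. x} else {})"
    using assms by (auto simp: proper_chains_def PiE_iff extensional_def fun_eq_iff)
  then show ?thesis
    by (simp add: chain_sum_def chain_length_def)
qed

text \<open>Cutting off the last point \<open>y\<close> turns a chain into a shorter one ending at
  some \<open>z\<close> different from \<open>y\<close>, and the last step contributes the factor
  \<open>exp (- d z y)\<close>. The zero diagonal of \<open>offdiag_zeta\<close> then lets
  \<open>z\<close> range over all of \<open>X\<close>.\<close>

lemma chain_sum_Suc:
  assumes "finite X" "y \<in> X"
  shows "chain_sum X d (Suc n) x y = (\<Sum>z\<in>X. chain_sum X d n x z * offdiag_zeta d z y)"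
proof -
  let ?C = "\<lambda>n z. {c \<in> proper_chains X n. c 0 = x \<and> c n = z}"
  have "chain_sum X d (Suc n) x y =
      (\<Sum>(z, c)\<in>(SIGMA z:X - {y}. ?C n z). exp (- chain_length d n c) * offdiag_zeta d z y)"
    unfolding chain_sum_def
  \<comment> \<open>The shortened chain must be restricted, since tuples are extensional functions;
    the update at \<open>Suc n\<close> restores the value lost.\<close>
  proof (rule sum.reindex_bij_witness[where i = "\<lambda>(z, c). c(Suc n := y)"
        and j = "\<lambda>c. (c n, restrict c {0..n})"])
    fix c assume c: "c \<in> ?C (Suc n) y"
    then have ext: "c \<in> extensional {0..Suc n}" and X: "\<And>i. i \<le> Suc n \<Longrightarrow> c i \<in> X"
      by (auto simp: proper_chains_def PiE_iff)
    have "c (Suc n - 1) \<noteq> c (Suc n)"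
      using c unfolding proper_chains_def by force
    then have neq: "c n \<noteq> y"
      using c by simp
    show "(case (c n, restrict c {0..n}) of (z, c) \<Rightarrow> c(Suc n := y)) = c"
    proof
      fix i
      show "(case (c n, restrict c {0..n}) of (z, c) \<Rightarrow> c(Suc n := y)) i = c i"
        using c ext by (auto simp: extensional_def)
    qed
    show "(c n, restrict c {0..n}) \<in> (SIGMA z:X - {y}. ?C n z)"
      using c neq X by (auto simp: proper_chains_def)
    have "chain_length d n (restrict c {0..n}) = chain_length d n c"
      by (auto simp: chain_length_def intro!: sum.cong)
    then show "(case (c n, restrict c {0..n}) of
        (z, c) \<Rightarrow> exp (- chain_length d n c) * offdiag_zeta d z y) =
        exp (- chain_length d (Suc n) c)"
      using c neq by (simp add: offdiag_zeta_def chain_length_def exp_diff exp_minus field_simps)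
  next
    fix p assume p: "p \<in> (SIGMA z:X - {y}. ?C n z)"
    then obtain c where c: "p = (c n, c)" "c n \<noteq> y" "c \<in> proper_chains X n" "c 0 = x"
      by auto
    have ext: "c \<in> extensional {0..n}"
      using c by (auto simp: proper_chains_def PiE_iff)
    have "restrict (c(Suc n := y)) {0..n} = c"
      using ext by (auto simp: fun_eq_iff extensional_def)
    then show "(((case p of (z, c) \<Rightarrow> c(Suc n := y)) n),
        restrict (case p of (z, c) \<Rightarrow> c(Suc n := y)) {0..n}) = p"
      using c by simp
    have "(c(Suc n := y)) (k - 1) \<noteq> (c(Suc n := y)) k" if "k \<in> {1..Suc n}" for k
      using that c by (cases "k = Suc n") (auto simp: proper_chains_def)
    then show "(case p of (z, c) \<Rightarrow> c(Suc n := y)) \<in> ?C (Suc n) y"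
      using c assms(2) by (auto simp: proper_chains_def PiE_iff extensional_def)
  qed
  also have "\<dots> = (\<Sum>z\<in>X - {y}. chain_sum X d n x z * offdiag_zeta d z y)"
    using assms(1) by (simp add: sum.Sigma[symmetric] chain_sum_def sum_distrib_right)
  also have "\<dots> = (\<Sum>z\<in>X. chain_sum X d n x z * offdiag_zeta d z y)"
    using assms(1) by (intro sum.mono_neutral_left) (auto simp: offdiag_zeta_def)
  finally show ?thesis .
qed

text \<open>Splitting off the first step instead of the last. Induction from
  \<open>chain_sum_Suc\<close> avoids a second bijection with shifted indices; it is the fact that a
  matrix commutes with its powers.\<close>

lemma chain_sum_Suc':
  assumes "finite X" "x \<in> X" "y \<in> X"
  shows "chain_sum X d (Suc n) x y = (\<Sum>z\<in>X. offdiag_zeta d x z * chain_sum X d n z y)"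
  using assms(3)
proof (induction n arbitrary: y)
  case 0
  have "chain_sum X d (Suc 0) x y = offdiag_zeta d x y"
    using assms 0 by (simp add: chain_sum_Suc chain_sum_0 if_distrib if_distribR cong: if_cong)
  also have "\<dots> = (\<Sum>z\<in>X. offdiag_zeta d x z * chain_sum X d 0 z y)"
    using assms(1) 0 by (simp add: chain_sum_0 if_distrib cong: if_cong)
  finally show ?case .
next
  case (Suc n)
  have "chain_sum X d (Suc (Suc n)) x y =
      (\<Sum>w\<in>X. \<Sum>z\<in>X. offdiag_zeta d x z * chain_sum X d n z w * offdiag_zeta d w y)"
    using assms(1) Suc by (simp add: chain_sum_Suc[of X y] sum_distrib_right)
  also have "\<dots> = (\<Sum>z\<in>X. \<Sum>w\<in>X. offdiag_zeta d x z * chain_sum X d n z w * offdiag_zeta d w y)"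
    by (rule sum.swap)
  also have "\<dots> = (\<Sum>z\<in>X. offdiag_zeta d x z * chain_sum X d (Suc n) z y)"
    using assms(1) Suc.prems by (simp add: chain_sum_Suc[of X y] sum_distrib_left mult.assoc)
  finally show ?case .
qed

lemma chain_sum_nonneg: "chain_sum X d n x y \<ge> 0"
  by (simp add: chain_sum_def sum_nonneg)

text \<open>By the recursion, each further step adds up \<open>card X\<close> products, each at most
  the previous bound times \<open>e\<close>.\<close>

lemma chain_sum_le_power:
  fixes e :: real
  assumes "finite X" "x \<in> X" "y \<in> X"
    and small: "\<And>u v. u \<in> X \<Longrightarrow> v \<in> X \<Longrightarrow> offdiag_zeta d u v \<le> e"
  shows "chain_sum X d n x y \<le> (card X * e) ^ n"
  using assms(3)
proof (induction n arbitrary: y)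
  case 0
  then show ?case
    using assms(2) by (simp add: chain_sum_0)
next
  case (Suc n)
  \<comment> \<open>The bound \<open>e\<close> also dominates a diagonal entry, which is 0.\<close>
  have "0 \<le> e"
    using small[OF Suc.prems Suc.prems] by (simp add: offdiag_zeta_def)
  then have "(\<Sum>z\<in>X. chain_sum X d n x z * offdiag_zeta d z y) \<le> (\<Sum>z\<in>X. (card X * e) ^ n * e)"
    using Suc small by (intro sum_mono mult_mono) (auto simp: offdiag_zeta_def)
  then show ?case
    using assms(1) Suc.prems by (simp add: chain_sum_Suc mult_ac)
qed


subsection \<open>Inverses of the zeta matrix\<close>

lemma sum_zeta_matrix_left:
  assumes "finite X" "Metric_space X d" "x \<in> X"
  shows "(\<Sum>z\<in>X. zeta_matrix d x z * f z) = f x + (\<Sum>z\<in>X. offdiag_zeta d x z * f z)"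
proof -
  have "d x x = 0"
    using assms by (simp add: Metric_space.mdist_zero)
  then have "zeta_matrix d x z * f z =
      (if x = z then f z else 0) + offdiag_zeta d x z * f z" for z
    by (auto simp: zeta_matrix_def offdiag_zeta_def)
  then show ?thesis
    using assms by (simp add: sum.distrib)
qed

text \<open>Symmetry of the metric reduces this to the product from the other side.\<close>

lemma sum_zeta_matrix_right:
  assumes "finite X" "Metric_space X d" "y \<in> X"
  shows "(\<Sum>z\<in>X. f z * zeta_matrix d z y) = f y + (\<Sum>z\<in>X. f z * offdiag_zeta d z y)"
proof -
  have "zeta_matrix d z y = zeta_matrix d y z" "offdiag_zeta d z y = offdiag_zeta d y z" for z
    using assms by (auto simp: zeta_matrix_def offdiag_zeta_def Metric_space.commute)
  then show ?thesis
    using sum_zeta_matrix_left[OF assms, of f] by (simp add: mult.commute)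
qed

text \<open>Let S be the sum of the series and Z = 1 + A. Multiplying by A from either side raises
  the index by one and flips the sign, so A S = S A = 1 - S and Z S = S Z = 1. As \<open>X\<close>
  is finite, matrix products may be exchanged with the infinite sums.\<close>

lemma chain_series_inverse_zeta_matrix:
  assumes fin: "finite X" and metric: "Metric_space X d"
    and conv: "\<And>x y. x \<in> X \<Longrightarrow> y \<in> X \<Longrightarrow> chain_series_abs_convergent X d (exp (-1)) x y"
  shows "inverse_matrices_on X (zeta_matrix d) (chain_series X d (exp (-1)))"
proof -
  define s where "s = (\<lambda>n x y. (-1) ^ n * chain_sum X d n x y)"
  have summable: "summable (\<lambda>n. s n x y)" if "x \<in> X" "y \<in> X" for x y
    using summable_rabs_cancel[OF conv[OF that, unfolded chain_series_abs_convergent_def]]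
    by (subst summable_Suc_iff[symmetric]) (simp only: s_def chain_series_term_eq_chain_sum)
  \<comment> \<open>The Kronecker delta in \<open>chain_series\<close> is the term of index
    0.\<close>
  have series: "chain_series X d (exp (-1)) x y = (\<Sum>n. s n x y)" if "x \<in> X" "y \<in> X" for x y
    using suminf_split_head[OF summable[OF that]] that
    by (simp add: chain_series_def chain_series_term_eq_chain_sum s_def chain_sum_0)
  have Suc: "(\<Sum>n. s (Suc n) x y) = (\<Sum>n. s n x y) - (if x = y then 1 else 0)"
    if "x \<in> X" "y \<in> X" for x y
    using suminf_split_head[OF summable[OF that]] that by (simp add: s_def chain_sum_0)
  have left: "(\<Sum>z\<in>X. zeta_matrix d x z * chain_series X d (exp (-1)) z y) = (if x = y then 1 else 0)"
    if "x \<in> X" "y \<in> X" for x y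
  proof -
    have "(\<Sum>z\<in>X. offdiag_zeta d x z * (\<Sum>n. s n z y)) =
        (\<Sum>z\<in>X. \<Sum>n. offdiag_zeta d x z * s n z y)"
      using summable that by (intro sum.cong refl suminf_mult[symmetric])
    also have "\<dots> = (\<Sum>n. \<Sum>z\<in>X. offdiag_zeta d x z * s n z y)"
      using summable that by (intro suminf_sum[symmetric] summable_mult)
    \<comment> \<open>Multiplication from the left uses the first-step recursion
      \<open>chain_sum_Suc'\<close>; the other side below uses \<open>chain_sum_Suc\<close>.\<close>
    also have "(\<lambda>n. \<Sum>z\<in>X. offdiag_zeta d x z * s n z y) = (\<lambda>n. - s (Suc n) x y)"
      using fin that by (simp add: s_def chain_sum_Suc' sum_distrib_left mult_ac)
    also have "(\<Sum>n. - s (Suc n) x y) = - (\<Sum>n. s (Suc n) x y)"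
      using summable[OF that] by (intro suminf_minus) (simp add: summable_Suc_iff[of "\<lambda>n. s n x y"])
    finally show ?thesis
      using that by (simp add: sum_zeta_matrix_left[OF fin metric] series Suc)
  qed
  have right: "(\<Sum>z\<in>X. chain_series X d (exp (-1)) x z * zeta_matrix d z y) = (if x = y then 1 else 0)"
    if "x \<in> X" "y \<in> X" for x y
  proof -
    have "(\<Sum>z\<in>X. (\<Sum>n. s n x z) * offdiag_zeta d z y) =
        (\<Sum>z\<in>X. \<Sum>n. s n x z * offdiag_zeta d z y)"
      using summable that by (intro sum.cong refl suminf_mult2)
    also have "\<dots> = (\<Sum>n. \<Sum>z\<in>X. s n x z * offdiag_zeta d z y)"
      using summable that by (intro suminf_sum[symmetric] summable_mult2)
    also have "(\<lambda>n. \<Sum>z\<in>X. s n x z * offdiag_zeta d z y) = (\<lambda>n. - s (Suc n) x y)"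
      using fin that by (simp add: s_def chain_sum_Suc sum_distrib_left mult_ac)
    also have "(\<Sum>n. - s (Suc n) x y) = - (\<Sum>n. s (Suc n) x y)"
      using summable[OF that] by (intro suminf_minus) (simp add: summable_Suc_iff[of "\<lambda>n. s n x y"])
    finally show ?thesis
      using that by (simp add: sum_zeta_matrix_right[OF fin metric] series Suc)
  qed
  show ?thesis
    using left right by (simp add: inverse_matrices_on_def)
qed

text \<open>B = B (A C) = (B A) C = C, read off at the entry \<open>x\<close>,
  \<open>y\<close>.\<close>

lemma inverse_matrices_on_unique:
  assumes "finite X" "inverse_matrices_on X A B" "inverse_matrices_on X A C" "x \<in> X" "y \<in> X"
  shows "B x y = C x y"
proof -
  have BA: "(\<Sum>z\<in>X. B x z * A z w) = (if x = w then 1 else 0)" if "w \<in> X" for w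
    using assms(2,4) that by (simp only: inverse_matrices_on_def)
  have AC: "(\<Sum>w\<in>X. A z w * C w y) = (if z = y then 1 else 0)" if "z \<in> X" for z
    using assms(3,5) that by (simp only: inverse_matrices_on_def)
  have "(\<Sum>z\<in>X. B x z * (\<Sum>w\<in>X. A z w * C w y)) = (\<Sum>z\<in>X. \<Sum>w\<in>X. B x z * A z w * C w y)"
    by (simp add: sum_distrib_left mult.assoc)
  also have "\<dots> = (\<Sum>w\<in>X. \<Sum>z\<in>X. B x z * A z w * C w y)"
    by (rule sum.swap)
  also have "\<dots> = (\<Sum>w\<in>X. (\<Sum>z\<in>X. B x z * A z w) * C w y)"
    by (simp add: sum_distrib_right)
  finally show ?thesis
    using assms(1,4,5) by (simp add: AC BA mult_if_delta if_distrib[of "(*) _"] cong: if_cong)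
qed

lemma matrix_inverse_on_eq:
  assumes "finite X" "inverse_matrices_on X A B" "x \<in> X" "y \<in> X"
  shows "matrix_inverse_on X A x y = B x y"
proof (rule inverse_matrices_on_unique[OF assms(1) _ assms(2-4)])
  show "inverse_matrices_on X A (matrix_inverse_on X A)"
    unfolding matrix_inverse_on_def using assms(2) by (rule someI[of "inverse_matrices_on X A"])
qed


subsection \<open>Convergence of the magnitude\<close>

text \<open>Each partial sum of the magnitude is a finite sum, over pairs of endpoints, of partial
  sums of convergent series.\<close>

lemma mu_magnitude_upto_LIMSEQ:
  assumes fin: "finite X"
    and conv: "\<And>x y. x \<in> X \<Longrightarrow> y \<in> X \<Longrightarrow> chain_series_abs_convergent X d (exp (-1)) x y"
  shows "mu_magnitude_upto X d (count_space X) \<longlonglongrightarrow>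
    (\<Sum>x\<in>X. \<Sum>y\<in>X. chain_series X d (exp (-1)) x y)"
proof -
  let ?t = "\<lambda>x y n. chain_series_term X d (exp (-1)) x y (Suc n)"
  \<comment> \<open>The initial term, the mass of \<open>X\<close>, is \<open>card X\<close> and so
    equals the sum of the Kronecker deltas over all pairs.\<close>
  have upto: "mu_magnitude_upto X d (count_space X) N =
      (\<Sum>x\<in>X. \<Sum>y\<in>X. (if x = y then 1 else 0) + (\<Sum>n<N. ?t x y n))" for N
  proof -
    have "(\<Sum>n=1..N. (-1) ^ n * (\<Sum>x\<in>X. \<Sum>y\<in>X. chain_sum X d n x y)) =
        (\<Sum>n<N. \<Sum>x\<in>X. \<Sum>y\<in>X. ?t x y n)"
      by (simp add: sum.atLeast1_atMost_eq chain_series_term_eq_chain_sum sum_distrib_left)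
    also have "\<dots> = (\<Sum>x\<in>X. \<Sum>n<N. \<Sum>y\<in>X. ?t x y n)"
      by (rule sum.swap)
    also have "\<dots> = (\<Sum>x\<in>X. \<Sum>y\<in>X. \<Sum>n<N. ?t x y n)"
      by (intro sum.cong refl sum.swap)
    finally show ?thesis
      using fin by (simp add: mu_magnitude_upto_def set_integral_proper_chains sum_proper_chains
          sum.distrib)
  qed
  have "summable (?t x y)" if "x \<in> X" "y \<in> X" for x y
    using conv[OF that] by (auto simp: chain_series_abs_convergent_def intro: summable_rabs_cancel)
  then show ?thesis
    unfolding upto chain_series_def by (intro tendsto_intros summable_LIMSEQ)
qed

lemma mu_magnitude_eq_classical:
  assumes fin: "finite X"
    and conv: "\<And>x y. x \<in> X \<Longrightarrow> y \<in> X \<Longrightarrow> chain_series_abs_convergent X d (exp (-1)) x y"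
    and eq: "\<And>x y. x \<in> X \<Longrightarrow> y \<in> X \<Longrightarrow>
      chain_series X d (exp (-1)) x y = matrix_inverse_on X (zeta_matrix d) x y"
  shows "mu_magnitude_exists X d (count_space X)"
    and "mu_magnitude X d (count_space X) = ereal (classical_magnitude X d)"
proof -
  have "mu_magnitude_upto X d (count_space X) \<longlonglongrightarrow> classical_magnitude X d"
    using mu_magnitude_upto_LIMSEQ[OF fin conv] eq by (simp add: classical_magnitude_def)
  then have "(\<lambda>N. ereal (mu_magnitude_upto X d (count_space X) N))
      \<longlonglongrightarrow> ereal (classical_magnitude X d)"
    by simp
  then show "mu_magnitude_exists X d (count_space X)"
    and "mu_magnitude X d (count_space X) = ereal (classical_magnitude X d)"
    by (auto simp: mu_magnitude_exists_def mu_magnitude_def convergent_def intro: limI)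
qed

text \<open>Comparison with the geometric series of ratio \<open>card X * e\<close>.\<close>

lemma chain_series_abs_convergent_if_small:
  fixes e :: real
  assumes "finite X" "x \<in> X" "y \<in> X"
    and "\<And>u v. u \<in> X \<Longrightarrow> v \<in> X \<Longrightarrow> offdiag_zeta d u v \<le> e" and "card X * e < 1"
  shows "chain_series_abs_convergent X d (exp (-1)) x y"
proof -
  have "0 \<le> e"
    using assms(4)[OF assms(2) assms(2)] by (simp add: offdiag_zeta_def)
  then have geom: "summable (\<lambda>n. (card X * e) ^ n)"
    using assms(5) by (intro summable_geometric) simp
  have "norm (chain_sum X d n x y) \<le> (card X * e) ^ n" for n
    using chain_sum_le_power[OF assms(1-4)] by (simp add: chain_sum_nonneg)
  then have "summable (\<lambda>n. chain_sum X d n x y)"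
    by (intro summable_comparison_test'[OF geom])
  then have "summable (\<lambda>n. chain_sum X d (Suc n) x y)"
    by (simp add: summable_Suc_iff[of "\<lambda>n. chain_sum X d n x y"])
  then show ?thesis
    by (simp add: chain_series_abs_convergent_def chain_series_term_eq_chain_sum abs_mult
        chain_sum_nonneg)
qed

lemma Metric_space_scale:
  assumes "Metric_space X d" "t > 0"
  shows "Metric_space X (\<lambda>x y. t * d x y)"
proof -
  interpret Metric_space X d by fact
  show ?thesis
    using assms(2) triangle
    by unfold_locales (auto simp: commute distrib_left[symmetric])
qed

text \<open>Each off-diagonal entry tends to 0 because the distance is positive, and finitely many
  pairs admit a common threshold.\<close>

lemma offdiag_zeta_scale_small:
  assumes "finite X" "Metric_space X d" "e > 0"
  shows "\<forall>\<^sub>F t in at_top. \<forall>x\<in>X. \<forall>y\<in>X. offdiag_zeta (\<lambda>x y. t * d x y) x y \<le> e"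
proof (intro eventually_ball_finite assms(1) ballI)
  fix x y assume xy: "x \<in> X" "y \<in> X"
  show "\<forall>\<^sub>F t in at_top. offdiag_zeta (\<lambda>x y. t * d x y) x y \<le> e"
  proof (cases "x = y")
    case False
    then have "d x y > 0"
      using xy assms(2) by (simp add: Metric_space.mdist_pos_less)
    then have "((\<lambda>t. exp (- (t * d x y))) \<longlongrightarrow> 0) at_top"
      by real_asymp
    then have "\<forall>\<^sub>F t in at_top. exp (- (t * d x y)) < e"
      using assms(3) by (rule order_tendstoD)
    then show ?thesis
      by eventually_elim (use False in \<open>simp add: offdiag_zeta_def\<close>)
  qed (use assms(3) in \<open>simp add: offdiag_zeta_def\<close>)
qed

theorem theorem3p7:
  fixes X :: "'a set" and d :: "'a \<Rightarrow> 'a \<Rightarrow> real"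
  assumes "finite X" and "Metric_space X d"
  shows
    "(\<forall>\<Omega> :: 'a \<Rightarrow> 'a \<Rightarrow> 'g set.
        unique_formal_geodesics X \<Omega> \<and> mu_magnitude_exists X d (count_space X) \<longrightarrow>
          mu_Gamma_magnitude_exists X d (count_space X) (Gamma_triv \<Omega>) \<and>
          mu_Gamma_magnitude_exists X d (count_space X) (Gamma_sharp \<Omega>) \<and>
          mu_Gamma_magnitude X d (count_space X) (Gamma_triv \<Omega>) =
            mu_Gamma_magnitude X d (count_space X) (Gamma_sharp \<Omega>) \<and>
          mu_Gamma_magnitude X d (count_space X) (Gamma_sharp \<Omega>) =
            mu_magnitude X d (count_space X))
     \<and>
     (invertible_matrix_on X (zeta_matrix d) \<and>
      (\<forall>x\<in>X. \<forall>y\<in>X. chain_series_abs_convergent X d (exp (-1)) x y \<and>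
         chain_series X d (exp (-1)) x y = matrix_inverse_on X (zeta_matrix d) x y) \<longrightarrow>
        mu_magnitude_exists X d (count_space X) \<and>
        mu_magnitude X d (count_space X) = ereal (classical_magnitude X d))
     \<and>
     (\<exists>t0>0. \<forall>t\<ge>t0.
        mu_magnitude_exists X (\<lambda>x y. t * d x y) (count_space X) \<and>
        invertible_matrix_on X (zeta_matrix (\<lambda>x y. t * d x y)) \<and>
        mu_magnitude X (\<lambda>x y. t * d x y) (count_space X) =
          ereal (classical_magnitude X (\<lambda>x y. t * d x y)))"
proof -
  have upto:
    "mu_Gamma_magnitude_upto X d (count_space X) (Gamma_triv \<Omega>) = mu_magnitude_upto X d (count_space X)"
    "mu_Gamma_magnitude_upto X d (count_space X) (Gamma_sharp \<Omega>) = mu_magnitude_upto X d (count_space X)"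
    if "unique_formal_geodesics X \<Omega>" for \<Omega> :: "'a \<Rightarrow> 'a \<Rightarrow> 'g set"
    using assms(1) that
    by (auto intro!: mu_Gamma_magnitude_upto_eq simp: Gamma_triv_eq_count_space Gamma_sharp_def)
  show ?thesis
  proof (intro conjI allI impI, goal_cases)
    case (1 \<Omega>)
    then show ?case
      by (simp add: mu_Gamma_magnitude_exists_def mu_magnitude_exists_def upto)
  next
    case (2 \<Omega>)
    then show ?case
      by (simp add: mu_Gamma_magnitude_exists_def mu_magnitude_exists_def upto)
  next
    case (3 \<Omega>)
    then show ?case
      by (simp add: mu_Gamma_magnitude_def upto)
  next
    case (4 \<Omega>)
    then show ?case
      by (simp add: mu_Gamma_magnitude_def mu_magnitude_def upto)
  next
    case 5
    then show ?case
      using assms(1) by (intro mu_magnitude_eq_classical) auto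
  next
    case 6
    then show ?case
      using assms(1) by (intro mu_magnitude_eq_classical) auto
  next
    case 7
    \<comment> \<open>Adding 1 to the cardinality makes \<open>card X * e < 1\<close> strict and
      keeps \<open>e\<close> positive for empty \<open>X\<close>.\<close>
    define e :: real where "e = 1 / (card X + 1)"
    have e: "e > 0" "card X * e < 1"
      by (auto simp: e_def)
    obtain t0 where t0: "\<And>t x y. t \<ge> t0 \<Longrightarrow> x \<in> X \<Longrightarrow> y \<in> X \<Longrightarrow>
        offdiag_zeta (\<lambda>x y. t * d x y) x y \<le> e"
      using offdiag_zeta_scale_small[OF assms e(1)] by (auto simp: eventually_at_top_linorder)
    show ?case
    \<comment> \<open>The maximum with 1 keeps the scaling factor positive, so the scaled distance
      is again a metric.\<close>
    proof (rule exI[of _ "max t0 1"], safe)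
      fix t assume t: "t \<ge> max t0 1"
      let ?d = "\<lambda>x y. t * d x y"
      have metric: "Metric_space X ?d"
        using assms(2) t by (intro Metric_space_scale) auto
      have conv: "chain_series_abs_convergent X ?d (exp (-1)) x y" if "x \<in> X" "y \<in> X" for x y
        using t0[of t] t e(2) by (intro chain_series_abs_convergent_if_small[OF assms(1) that, of _ e]) auto
      note inverse = chain_series_inverse_zeta_matrix[OF assms(1) metric conv]
      show "invertible_matrix_on X (zeta_matrix ?d)"
        using inverse by (auto simp: invertible_matrix_on_def)
      show "mu_magnitude_exists X ?d (count_space X)"
        and "mu_magnitude X ?d (count_space X) = ereal (classical_magnitude X ?d)"
        using mu_magnitude_eq_classical[OF assms(1) conv] matrix_inverse_on_eq[OF assms(1) inverse]
        by auto
    qed simp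
  qed
qed

end
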